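(* Let $n$ be a positive integer, let $V:\mathcal S_0^n\to\mathbb R$ be a radial continuous valuation, and let $\overline V:\mathcal S_b^n\to\mathbb R$ be its radial continuous extension to a valuation on the bounded Borel star sets (the one described in the context). Then there exist a measure $\mu$ defined on the Borel sets of $S^{n-1}$ and a function $K:\mathbb R^+\times S^{n-1}\to\mathbb R$ such that, for every star set $L$ whose radial function $\rho_L$ is a simple Borel function, $$\overline V(L)=\int_{S^{n-1}}K(\rho_L(t),t)\,d\mu(t).$$
   Context: $\mathbb R^+=[0,\infty)$. A set $L\subset\mathbb R^n$ is a star set if it contains the origin and every line through $0$ that meets $L$ does so in a (possibly degenerate) line segment. Its radial function is $\rho_L(t)=\sup\{c\ge 0: ct\in L\}$, $t\in S^{n-1}$. Star sets are identified with their radial functions. $L$ is a star body if $\rho_L$ is continuous, and a bounded Borel star set if $\rho_L$ is a bounded Borel function. $\mathcal S_0^n$, $\mathcal S_b^n$ denote the sets of star bodies and of bounded Borel star sets; they correspond to $C(S^{n-1})^+$ (nonnegative continuous functions) and $B(\Sigma_n)^+$ (nonnegative bounded Borel functions), where $\Sigma_n$ is the Borel $\sigma$-algebra of $S^{n-1}$. Radial continuity is continuity for $\delta(K,L)=\|\rho_K-\rho_L\|_\infty$. $V$ is a valuation if $V(K\cup L)+V(K\cap L)=V(K)+V(L)$. A simple Borel function is one of the form $\sum_{i=1}^M a_i\chi_{A_i}$ with $a_i\ge0$ and $A_i$ Borel. The integral formula includes the assertion that the integrand is $\mu$-integrable. The extension $\overline V$. For $f\in C(S^{n-1})^+$ let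 $\tilde V(f)=V(L_f)$, where $L_f$ is the star body with radial function $f$. First suppose $\tilde V\geq 0$ and $\tilde V(0)=0$. For $\lambda\ge0$ and closed $C\subset S^{n-1}$ put $\zeta_\lambda(C)=\inf\{\tilde V(f): f\in C(S^{n-1})^+,\ f\ge\lambda\text{ on }C,\ \|f\|_\infty\le\lambda\}$, and for Borel $A$ put $\nu_\lambda(A)=\inf\{\sup\{\zeta_\lambda(C): C\subset G,\ C\text{ closed}\}: G\text{ open},\ A\subset G\}$; $\nu_\lambda$ is a finite Borel measure. For a simple function $g=\sum_{i=1}^M a_i\chi_{A_i}$ with pairwise disjoint Borel $A_i$ and $a_i\ge0$, $\overline V(g)=\sum_{i=1}^M\nu_{a_i}(A_i)$; for $f\in B(\Sigma_n)^+$, $\overline V(f)=\lim_k\overline V(f_k)$ for any sequence of nonnegative simple Borel functions $f_k\to f$ uniformly (the limit exists and is independent of the sequence). For general $V$, write $\tilde V-\tilde V(0)=\tilde V_1-\tilde V_2$ with $\tilde V_1,\tilde V_2\ge 0$ continuous valuations on $C(S^{n-1})^+$ vanishing at $0$ (such a decomposition exists), and set $\overline V=\tilde V(0)+\overline V_1-\overline V_2$. Then $\overline V$, regarded as a function on $\mathcal S_b^n$ through radial functions, is a radial continuous valuation extending $V$. *)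

theory Defs
  imports "HOL-Analysis.Analysis"
begin

abbreviation unit_sphere :: "(real ^ 'n) set" where
  "unit_sphere \<equiv> sphere 0 1"

abbreviation sphere_borel :: "(real ^ 'n) measure" where
  "sphere_borel \<equiv> restrict_space borel unit_sphere"

text \<open>Functions on the sphere are functions on the whole space of which only the values on
  \<^term>\<open>unit_sphere\<close> matter.\<close>

definition sup_norm :: "(real ^ 'n \<Rightarrow> real) \<Rightarrow> real" where
  "sup_norm f = (SUP t\<in>unit_sphere. \<bar>f t\<bar>)"


subsection \<open>Star sets and valuations\<close>

text \<open>Line segments are closed, so that a star set is determined by its radial function.
  Since \<open>0 \<in> L\<close>, every line through \<open>0\<close> meets \<open>L\<close>.\<close>

definition star_set :: "(real ^ 'n) set \<Rightarrow> bool" where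
  "star_set L \<longleftrightarrow> 0 \<in> L \<and> (\<forall>v. v \<noteq> 0 \<longrightarrow> (\<exists>a b. L \<inter> span {v} = closed_segment a b))"

definition radial :: "(real ^ 'n) set \<Rightarrow> real ^ 'n \<Rightarrow> real" where
  "radial L t = Sup {c. 0 \<le> c \<and> c *\<^sub>R t \<in> L}"

text \<open>The star set with a given nonnegative radial function.\<close>

definition star_of :: "(real ^ 'n \<Rightarrow> real) \<Rightarrow> (real ^ 'n) set" where
  "star_of f = {c *\<^sub>R t | c t. t \<in> unit_sphere \<and> 0 \<le> c \<and> c \<le> f t}"

definition star_body :: "(real ^ 'n) set \<Rightarrow> bool" where
  "star_body L \<longleftrightarrow> star_set L \<and> continuous_on unit_sphere (radial L)"

definition bounded_borel_star_set :: "(real ^ 'n) set \<Rightarrow> bool" where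
  "bounded_borel_star_set L \<longleftrightarrow>
     star_set L \<and> radial L \<in> borel_measurable sphere_borel \<and> bounded (radial L ` unit_sphere)"

definition radial_dist :: "(real ^ 'n) set \<Rightarrow> (real ^ 'n) set \<Rightarrow> real" where
  "radial_dist K L = sup_norm (\<lambda>t. radial K t - radial L t)"

definition valuation :: "((real ^ 'n) set \<Rightarrow> real) \<Rightarrow> bool" where
  "valuation V \<longleftrightarrow>
     (\<forall>K L. star_body K \<and> star_body L \<longrightarrow> V (K \<union> L) + V (K \<inter> L) = V K + V L)"

definition radial_continuous :: "((real ^ 'n) set \<Rightarrow> real) \<Rightarrow> bool" where
  "radial_continuous V \<longleftrightarrow>
     (\<forall>K. star_body K \<longrightarrow> (\<forall>\<epsilon>>0. \<exists>\<delta>>0. \<forall>L. star_body L \<and> radial_dist L K < \<delta> \<longrightarrow> \<bar>V L - V K\<bar> < \<epsilon>))"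


subsection \<open>The extension to bounded Borel star sets\<close>

definition zeta :: "((real ^ 'n) set \<Rightarrow> real) \<Rightarrow> real \<Rightarrow> (real ^ 'n) set \<Rightarrow> real" where
  "zeta V l C = Inf {V (star_of f) | f.
     continuous_on unit_sphere f \<and> (\<forall>t\<in>unit_sphere. 0 \<le> f t) \<and>
     (\<forall>t\<in>C. l \<le> f t) \<and> sup_norm f \<le> l}"

text \<open>\<open>G\<close> is open relative to the sphere; the sphere being closed, closedness of \<open>C\<close> in the
  sphere and in the whole space agree.\<close>

definition nu :: "((real ^ 'n) set \<Rightarrow> real) \<Rightarrow> real \<Rightarrow> (real ^ 'n) set \<Rightarrow> real" where
  "nu V l A = Inf {Sup {zeta V l C | C. closed C \<and> C \<subseteq> G} | G.
     openin (top_of_set unit_sphere) G \<and> A \<subseteq> G}"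

definition simple_borel :: "(real ^ 'n \<Rightarrow> real) \<Rightarrow> bool" where
  "simple_borel g \<longleftrightarrow>
     (\<exists>(M::nat) a A. (\<forall>i<M. 0 \<le> a i \<and> A i \<in> sets sphere_borel) \<and>
        (\<forall>t\<in>unit_sphere. g t = (\<Sum>i<M. a i * indicator (A i) t)))"

text \<open>The sum over the level sets of \<open>g\<close>. Any other representation of \<open>g\<close> with pairwise disjoint
  sets gives the same value, since each \<^term>\<open>nu V a\<close> is additive and \<^term>\<open>nu V 0\<close> vanishes
  (when \<open>V\<close> is nonnegative and \<^term>\<open>V {0} = 0\<close>).\<close>

definition simple_extension :: "((real ^ 'n) set \<Rightarrow> real) \<Rightarrow> (real ^ 'n \<Rightarrow> real) \<Rightarrow> real" where
  "simple_extension V g =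
     (\<Sum>a\<in>g ` unit_sphere. nu V a {t \<in> unit_sphere. g t = a})"

definition extension_value ::
  "((real ^ 'n) set \<Rightarrow> real) \<Rightarrow> (real ^ 'n \<Rightarrow> real) \<Rightarrow> real \<Rightarrow> bool" where
  "extension_value V f v \<longleftrightarrow>
     (\<forall>F. (\<forall>k. simple_borel (F k)) \<and> uniform_limit unit_sphere F f sequentially
        \<longrightarrow> (\<lambda>k. simple_extension V (F k)) \<longlonglongrightarrow> v)"

text \<open>\<open>(V1, V2)\<close> is a decomposition of \<open>V - V {0}\<close> into nonnegative radial continuous valuations
  vanishing at \<open>{0}\<close>, the star body whose radial function is \<open>0\<close>. Valuations on nonnegative
  continuous functions on the sphere are expressed as valuations on star bodies.\<close>

definition valuation_decomposition ::
  "((real ^ 'n) set \<Rightarrow> real) \<Rightarrow> ((real ^ 'n) set \<Rightarrow> real) \<Rightarrow> ((real ^ 'n) set \<Rightarrow> real) \<Rightarrow> bool" where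
  "valuation_decomposition V V1 V2 \<longleftrightarrow>
     valuation V1 \<and> radial_continuous V1 \<and> (\<forall>L. star_body L \<longrightarrow> 0 \<le> V1 L) \<and> V1 {0} = 0 \<and>
     valuation V2 \<and> radial_continuous V2 \<and> (\<forall>L. star_body L \<longrightarrow> 0 \<le> V2 L) \<and> V2 {0} = 0 \<and>
     (\<forall>L. star_body L \<longrightarrow> V L - V {0} = V1 L - V2 L)"

text \<open>The construction of the extension is a relation, which leaves the choice of the decomposition
  open.\<close>

definition borel_extension ::
  "((real ^ 'n) set \<Rightarrow> real) \<Rightarrow> ((real ^ 'n) set \<Rightarrow> real) \<Rightarrow> bool" where
  "borel_extension V Vbar \<longleftrightarrow>
     (\<exists>V1 V2. valuation_decomposition V V1 V2 \<and>
        (\<forall>L. bounded_borel_star_set L \<longrightarrow>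
           (\<exists>v1 v2. extension_value V1 (radial L) v1 \<and> extension_value V2 (radial L) v2 \<and>
              Vbar L = V {0} + v1 - v2)))"

end

theory Submission
  imports Defs
begin

text \<open>Existence of the limits that define the extension makes it continuous at simple functions for
  uniform convergence. This continuity alone yields that \<open>nu V a A\<close> is continuous in \<open>a\<close> and finitely
  additive in \<open>A\<close>; being outer regular on a compact space, it is then countably additive
  (Alexandroff). A finite measure \<open>\<mu>\<close> that dominates \<open>nu V\<^sub>1 q\<close> and \<open>nu V\<^sub>2 q\<close> for all rational
  \<open>q \<ge> 0\<close> dominates, by continuity in \<open>q\<close>, all of these measures, and \<open>K(a, \<cdot>)\<close> is the difference of
  the two Radon--Nikodym densities plus a constant.\<close>

section \<open>Alexandroff's theorem for regular set functions on a compact set\<close>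

text \<open>Since \<open>m\<close> has finite values, continuity at the empty set along decreasing
  sequences suffices. Outer regularity, applied to complements, allows approximation from inside by
  closed sets; compactness of \<open>S\<close> then reduces a decreasing sequence with empty
  intersection to finitely many of these.\<close>

lemma finitely_additive_regular_countably_additive:
  fixes m :: "'a::heine_borel set \<Rightarrow> real"
  assumes "compact S"
    and nonneg: "\<And>A. A \<in> sets (restrict_space borel S) \<Longrightarrow> 0 \<le> m A"
    and add: "\<And>A B. A \<in> sets (restrict_space borel S) \<Longrightarrow> B \<in> sets (restrict_space borel S) \<Longrightarrow>
      A \<inter> B = {} \<Longrightarrow> m (A \<union> B) = m A + m B"
    and outer: "\<And>A e. A \<in> sets (restrict_space borel S) \<Longrightarrow> 0 < e \<Longrightarrow>
      \<exists>G. openin (top_of_set S) G \<and> A \<subseteq> G \<and> m G < m A + e"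
  shows "countably_additive (sets (restrict_space borel S)) (\<lambda>A. ennreal (m A))"
proof -
  define M where "M = restrict_space borel S"
  note nonneg = nonneg[folded M_def] and add = add[folded M_def] and outer = outer[folded M_def]
  have "closed S" using \<open>compact S\<close> by (rule compact_imp_closed)
  have S_M: "space M = S" by (simp add: M_def space_restrict_space)
  have top_M: "S \<in> sets M" using sets.top[of M] by (simp add: S_M)
  have open_M: "G \<in> sets M" if "openin (top_of_set S) G" for G
    using that by (auto simp: M_def sets_restrict_space openin_open)
  have closed_M: "C \<in> sets M" if "closed C" "C \<subseteq> S" for C
    using that by (auto simp: M_def sets_restrict_space intro!: image_eqI[of _ _ C])
  have empty: "m {} = 0" using add[of "{}" "{}"] by simp
  have diff: "m (B - A) = m B - m A" if "A \<in> sets M" "B \<in> sets M" "A \<subseteq> B" for A B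
    using add[of A "B - A"] that by (simp add: Un_absorb1)
  have mono: "m A \<le> m B" if "A \<in> sets M" "B \<in> sets M" "A \<subseteq> B" for A B
    using diff[OF that] nonneg[of "B - A"] that by simp
  have subadd2: "m (A \<union> B) \<le> m A + m B" if "A \<in> sets M" "B \<in> sets M" for A B
    using add[of A "B - A"] mono[of "B - A" B] that by (simp add: Un_commute)
  have subadd: "m (\<Union>k\<in>{..n}. A k) \<le> (\<Sum>k\<le>n. m (A k))" if "\<And>k. A k \<in> sets M" for A and n :: nat
  proof (induction n)
    case (Suc n)
    have "m (\<Union>k\<in>{..Suc n}. A k) \<le> m (\<Union>k\<in>{..n}. A k) + m (A (Suc n))"
      using subadd2[of "\<Union>k\<in>{..n}. A k" "A (Suc n)"] that by (auto simp: atMost_Suc Un_commute)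
    with Suc show ?case by simp
  qed simp
  \<comment> \<open>The closed set is the complement in \<open>S\<close> of an open superset of
    \<open>S - A\<close>; what is lost from \<open>A\<close> is exactly what that superset has in
    excess.\<close>
  have inner: "\<exists>C. closed C \<and> C \<subseteq> A \<and> m (A - C) < e" if A: "A \<in> sets M" and "0 < e" for A e
  proof -
    have AS: "A \<subseteq> S" using sets.sets_into_space[OF A] S_M by simp
    have "S - A \<in> sets M" using A top_M by auto
    with outer \<open>0 < e\<close> obtain G
      where G: "openin (top_of_set S) G" "S - A \<subseteq> G" "m G < m (S - A) + e" by meson
    obtain T where T: "open T" "G = S \<inter> T" using G(1) by (auto simp: openin_open)
    have "closed (S - T)" using \<open>closed S\<close> T(1) by (rule closed_Diff)
    moreover have "A - (S - T) = G - (S - A)" using AS T by auto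
    ultimately show ?thesis
      using G T A diff[of "S - A" G] \<open>S - A \<in> sets M\<close> open_M[OF G(1)]
      by (intro exI[of _ "S - T"]) auto
  qed
  have lim: "(\<lambda>i. ennreal (m (A i))) \<longlonglongrightarrow> 0"
    if A: "range A \<subseteq> sets M" "decseq A" "(\<Inter>i. A i) = {}" for A :: "nat \<Rightarrow> 'a set"
  proof -
    have AM: "A k \<in> sets M" for k using A by auto
    have AS: "A k \<subseteq> S" for k using sets.sets_into_space[OF AM] S_M by simp
    have "(\<lambda>i. m (A i)) \<longlonglongrightarrow> 0"
    proof (rule LIMSEQ_I)
      fix e :: real assume "0 < e"
      \<comment> \<open>The errors are geometric, so that finitely many of them always add up to
        strictly less than \<open>e\<close>.\<close>
      have "\<forall>k. \<exists>C. closed C \<and> C \<subseteq> A k \<and> m (A k - C) < e * (1/2) ^ Suc k"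
        by (intro allI inner[OF AM]) (use \<open>0 < e\<close> in simp)
      then obtain C where "\<forall>k. closed (C k) \<and> C k \<subseteq> A k \<and> m (A k - C k) < e * (1/2) ^ Suc k"
        by (rule choice[THEN exE])
      then have C: "\<And>k. closed (C k)" "\<And>k. C k \<subseteq> A k"
        "\<And>k. m (A k - C k) < e * (1/2) ^ Suc k" by blast+
      have CM: "C k \<in> sets M" for k
        using closed_M[OF C(1)] order_trans[OF C(2) AS] .
      \<comment> \<open>The \<open>D n\<close> are nested compact sets inside the
        \<open>A n\<close>, so their intersection is empty and one of them is already empty.\<close>
      define D where "D n = S \<inter> (\<Inter>k\<in>{..n}. C k)" for n
      have "compact (D n)" for n
        unfolding D_def using \<open>compact S\<close> C by (intro compact_Int_closed closed_INT) auto
      moreover have "D n \<subseteq> D k" if "k \<le> n" for k n using that by (auto simp: D_def)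
      moreover have "(\<Inter>n. D n) = {}"
      proof -
        have "(\<Inter>n. D n) \<subseteq> A k" for k
          using C(2)[of k] INF_lower[of k UNIV D] by (auto simp: D_def)
        then show ?thesis using A(3) by blast
      qed
      ultimately obtain n where n: "D n = {}" using compact_nest[of D] by blast
      have "m (A i) < e" if "n \<le> i" for i
      proof -
        \<comment> \<open>A point of \<open>A i\<close> lies in every \<open>A k\<close> with
          \<open>k \<le> n\<close>, but, \<open>D n\<close> being empty, it misses some
          \<open>C k\<close>.\<close>
        have "A i \<subseteq> (\<Union>k\<in>{..n}. A k - C k)"
        proof
          fix x assume x: "x \<in> A i"
          have "x \<in> A k" if "k \<le> n" for k
            using x decseqD[OF A(2), of k i] that \<open>n \<le> i\<close> by auto
          moreover have "x \<in> S" using x AS by blast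
          ultimately show "x \<in> (\<Union>k\<in>{..n}. A k - C k)" using n by (auto simp: D_def)
        qed
        then have "m (A i) \<le> m (\<Union>k\<in>{..n}. A k - C k)"
          using AM CM by (intro mono) auto
        also have "\<dots> \<le> (\<Sum>k\<le>n. m (A k - C k))" using AM CM by (intro subadd) auto
        also have "\<dots> \<le> (\<Sum>k\<le>n. e * (1/2) ^ Suc k)" by (intro sum_mono less_imp_le C)
        also have "\<dots> = e * (1 - (1/2) ^ Suc n)"
          by (induction n) (auto simp: algebra_simps)
        also have "\<dots> < e" using \<open>0 < e\<close> by simp
        finally show ?thesis .
      qed
      then show "\<exists>no. \<forall>i\<ge>no. norm (m (A i) - 0) < e" using nonneg[OF AM] by auto
    qed
    then show ?thesis using tendsto_ennrealI by fastforce
  qed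
  have "countably_additive (sets M) (\<lambda>A. ennreal (m A))"
    using lim
    by (intro sets.empty_continuous_imp_countably_additive)
      (auto simp: positive_def additive_def empty add nonneg)
  then show ?thesis by (simp add: M_def)
qed

section \<open>Star sets with a prescribed radial function\<close>

lemma unit_sphere_nonempty: "unit_sphere \<noteq> ({} :: (real ^ 'n) set)"
  by simp

lemma sup_norm_const: "0 \<le> a \<Longrightarrow> sup_norm (\<lambda>_ :: real ^ 'n. a) = a"
  by (simp add: sup_norm_def unit_sphere_nonempty)

lemma radial_star_of:
  assumes "t \<in> unit_sphere" "0 \<le> f t"
  shows "radial (star_of f) t = f t"
proof -
  have "0 \<le> c \<and> c *\<^sub>R t \<in> star_of f \<longleftrightarrow> 0 \<le> c \<and> c \<le> f t" for c
  proof
    assume L: "0 \<le> c \<and> c *\<^sub>R t \<in> star_of f"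
    then obtain d s where d: "c *\<^sub>R t = d *\<^sub>R s" "norm s = 1" "0 \<le> d" "d \<le> f s"
      by (auto simp: star_of_def)
    have "norm (c *\<^sub>R t) = norm (d *\<^sub>R s)" by (simp only: d(1))
    then have "c = d" using L d(2,3) assms(1) by simp
    \<comment> \<open>A nonzero scalar forces \<open>s = t\<close>. At the origin the direction
      \<open>s\<close> is arbitrary, and the bound comes from \<open>0 \<le> f t\<close>.\<close>
    then show "0 \<le> c \<and> c \<le> f t" using d L assms by (cases "c = 0") auto
  qed (use assms in \<open>auto simp: star_of_def\<close>)
  then have "radial (star_of f) t = Sup {c. 0 \<le> c \<and> c \<le> f t}"
    unfolding radial_def by (rule arg_cong[OF Collect_cong])
  also have "{c. 0 \<le> c \<and> c \<le> f t} = {0..f t}" by auto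
  finally show ?thesis using assms(2) by simp
qed

text \<open>Each line through the origin is spanned by a unit vector \<open>u\<close>, and it meets
  the set in the segment from \<open>- f (- u)\<close> to \<open>f u\<close> in the coordinate along
  \<open>u\<close>; the two halves come from the antipodal directions \<open>u\<close> and
  \<open>- u\<close>.\<close>

lemma star_set_star_of:
  fixes f :: "real ^ 'n \<Rightarrow> real"
  assumes f: "\<And>t. t \<in> unit_sphere \<Longrightarrow> 0 \<le> f t"
  shows "star_set (star_of f)"
  unfolding star_set_def
proof (intro conjI allI impI)
  obtain t :: "real ^ 'n" where "t \<in> unit_sphere" using unit_sphere_nonempty by blast
  then show "0 \<in> star_of f" unfolding star_of_def using f[of t] by (auto intro!: exI[of _ 0] exI[of _ t])
next
  fix v :: "real ^ 'n" assume "v \<noteq> 0"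
  define u where "u = v /\<^sub>R norm v"
  have u: "norm u = 1" "v = norm v *\<^sub>R u" using \<open>v \<noteq> 0\<close> by (auto simp: u_def)
  have seg: "closed_segment ((- f (- u)) *\<^sub>R u) (f u *\<^sub>R u) = (\<lambda>c. c *\<^sub>R u) ` {- f (- u)..f u}"
  proof -
    have "0 \<le> f u" "0 \<le> f (- u)" using f[of u] f[of "- u"] u by auto
    then have "{- f (- u)..f u} = closed_segment (- f (- u)) (f u)"
      by (simp add: closed_segment_eq_real_ivl)
    moreover have "linear (\<lambda>c. c *\<^sub>R u)" by (simp add: linear_scale_left linearI algebra_simps)
    ultimately show ?thesis using closed_segment_linear_image by metis
  qed
  have "star_of f \<inter> span {v} = (\<lambda>c. c *\<^sub>R u) ` {- f (- u)..f u}"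
  proof (intro equalityI subsetI)
    fix x assume x: "x \<in> star_of f \<inter> span {v}"
    then obtain k where "x = k *\<^sub>R v" by (auto simp: span_singleton)
    then have xk: "x = (k * norm v) *\<^sub>R u" using u by (metis scaleR_scaleR)
    define c where "c = k * norm v"
    obtain d s where d: "x = d *\<^sub>R s" "norm s = 1" "0 \<le> d" "d \<le> f s"
      using x by (auto simp: star_of_def)
    have cu: "c *\<^sub>R u = d *\<^sub>R s" using xk d c_def by simp
    then have "norm (c *\<^sub>R u) = norm (d *\<^sub>R s)" by simp
    then have "\<bar>c\<bar> = d" using d u by simp
    have "c \<in> {- f (- u)..f u}"
    proof (cases "c = 0")
      case True
      then show ?thesis using f[of u] f[of "- u"] u by auto
    next
      case False
      consider "c = d" | "c = - d" using \<open>\<bar>c\<bar> = d\<close> by linarith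
      then show ?thesis
      proof cases
        case 1
        then have "s = u" using cu False by simp
        then show ?thesis using d 1 f[of "- u"] u by auto
      next
        case 2
        then have "d *\<^sub>R s = d *\<^sub>R (- u)" using cu by simp
        then have "s = - u" using 2 False by (simp only: scaleR_cancel_left) auto
        then show ?thesis using d 2 f[of u] u by auto
      qed
    qed
    then show "x \<in> (\<lambda>c. c *\<^sub>R u) ` {- f (- u)..f u}" using xk c_def by blast
  next
    fix x assume "x \<in> (\<lambda>c. c *\<^sub>R u) ` {- f (- u)..f u}"
    then obtain c where "x = c *\<^sub>R u" and "c \<in> {- f (- u)..f u}" by blast
    then have c: "x = c *\<^sub>R u" "- f (- u) \<le> c" "c \<le> f u" by auto
    have "x \<in> star_of f"
    proof (cases "0 \<le> c")
      case True
      then show ?thesis using c u unfolding star_of_def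
        by (intro CollectI exI[of _ c] exI[of _ u]) auto
    next
      case False
      then show ?thesis unfolding star_of_def using c u
        by (intro CollectI exI[of _ "- c"] exI[of _ "- u"]) auto
    qed
    moreover have "x = (c / norm v) *\<^sub>R v" using c \<open>v \<noteq> 0\<close> by (simp add: u_def divide_inverse)
    then have "x \<in> span {v}" by (auto simp: span_singleton)
    ultimately show "x \<in> star_of f \<inter> span {v}" by simp
  qed
  then show "\<exists>a b. star_of f \<inter> span {v} = closed_segment a b"
    unfolding seg[symmetric] by (intro exI)
qed

lemma star_body_star_of:
  assumes "continuous_on unit_sphere f" "\<And>t. t \<in> unit_sphere \<Longrightarrow> 0 \<le> f t"
  shows "star_body (star_of f)"
proof -
  have "continuous_on unit_sphere (radial (star_of f)) \<longleftrightarrow> continuous_on unit_sphere f"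
    by (rule continuous_on_cong) (simp_all add: radial_star_of assms(2))
  then show ?thesis using star_set_star_of[of f] assms by (simp add: star_body_def)
qed

lemma star_of_zero:
  fixes f :: "real ^ 'n \<Rightarrow> real"
  assumes "\<And>t. t \<in> unit_sphere \<Longrightarrow> f t = 0"
  shows "star_of f = {0}"
proof -
  obtain t :: "real ^ 'n" where "t \<in> unit_sphere" using unit_sphere_nonempty by blast
  then have "0 *\<^sub>R t \<in> star_of f"
    unfolding star_of_def using assms by (intro CollectI exI[of _ 0] exI[of _ t]) simp
  moreover have "x = 0" if "x \<in> star_of f" for x
    using that assms by (auto simp: star_of_def)
  ultimately show ?thesis by auto
qed

section \<open>Simple Borel functions\<close>

lemma simple_borelI:
  fixes g :: "real ^ 'n \<Rightarrow> real"
  assumes "g \<in> borel_measurable sphere_borel" "finite (g ` unit_sphere)"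
    "\<And>t. t \<in> unit_sphere \<Longrightarrow> 0 \<le> g t"
  shows "simple_borel g"
proof -
  \<comment> \<open>An injective enumeration of the values makes the level sets disjoint, so exactly
    one summand survives at each point.\<close>
  obtain a and M :: nat where a: "g ` unit_sphere = a ` {i. i < M}" "inj_on a {i. i < M}"
    using finite_imp_nat_seg_image_inj_on[OF assms(2)] by metis
  define A where "A i = {t \<in> unit_sphere. g t = a i}" for i
  have "A i \<in> sets sphere_borel" for i
  proof -
    have "A i = g -` {a i} \<inter> space sphere_borel" by (auto simp: A_def space_restrict_space)
    then show ?thesis using measurable_sets[OF assms(1)] by simp
  qed
  moreover have "0 \<le> a i" if "i < M" for i
  proof -
    have "a i \<in> g ` unit_sphere" using a(1) that by auto
    then show ?thesis using assms(3) by auto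
  qed
  moreover have "g t = (\<Sum>i<M. a i * indicator (A i) t)" if "t \<in> unit_sphere" for t
  proof -
    have "g t \<in> a ` {i. i < M}" using that a(1) by blast
    then obtain j where j: "j < M" "g t = a j" by auto
    have "(\<Sum>i<M. a i * indicator (A i) t) = (\<Sum>i<M. if i = j then a j else 0)"
      using that j a(2) by (intro sum.cong) (auto simp: A_def indicator_def inj_on_def)
    then show ?thesis using j by simp
  qed
  ultimately show ?thesis unfolding simple_borel_def by blast
qed

lemma simple_borel_measurable:
  assumes "simple_borel g"
  shows "g \<in> borel_measurable sphere_borel"
proof -
  obtain M :: nat and a A where A: "\<And>i. i < M \<Longrightarrow> A i \<in> sets sphere_borel"
    and g: "\<And>t. t \<in> unit_sphere \<Longrightarrow> g t = (\<Sum>i<M. a i * indicator (A i) t)"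
    using assms unfolding simple_borel_def by blast
  have "(\<lambda>t. \<Sum>i<M. a i * indicator (A i) t) \<in> borel_measurable sphere_borel"
    using A by (intro borel_measurable_sum borel_measurable_times borel_measurable_indicator) auto
  then show ?thesis using g by (subst measurable_cong) (auto simp: space_restrict_space)
qed

text \<open>The sets of a representation may overlap, so the values are sums over subsets of the
  coefficients, of which there are finitely many.\<close>

lemma simple_borel_finite:
  fixes g :: "real ^ 'n \<Rightarrow> real"
  assumes "simple_borel g"
  shows "finite (g ` unit_sphere)"
proof -
  obtain M :: nat and a and A :: "nat \<Rightarrow> (real ^ 'n) set"
    where g: "\<And>t. t \<in> unit_sphere \<Longrightarrow> g t = (\<Sum>i<M. a i * indicator (A i) t)"
    using assms unfolding simple_borel_def by blast
  have "g t = sum a {i. i < M \<and> t \<in> A i}" if "t \<in> unit_sphere" for t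
  proof -
    have "g t = (\<Sum>i<M. if t \<in> A i then a i else 0)"
      unfolding g[OF that] by (intro sum.cong) auto
    also have "\<dots> = sum a {i \<in> {..<M}. t \<in> A i}" by (rule sum.inter_filter[symmetric]) simp
    finally show ?thesis by simp
  qed
  then have "g ` unit_sphere \<subseteq> sum a ` Pow {i. i < M}" by auto
  then show ?thesis by (rule finite_subset) auto
qed

lemma simple_borel_nonneg: "simple_borel g \<Longrightarrow> t \<in> unit_sphere \<Longrightarrow> 0 \<le> g t"
  unfolding simple_borel_def by (elim exE conjE) (auto intro!: sum_nonneg)

lemma simple_borel_level_sets: "simple_borel g \<Longrightarrow> {t \<in> unit_sphere. g t = a} \<in> sets sphere_borel"
proof -
  assume "simple_borel g"
  have "{t \<in> unit_sphere. g t = a} = g -` {a} \<inter> space sphere_borel"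
    by (auto simp: space_restrict_space)
  then show ?thesis using measurable_sets[OF simple_borel_measurable[OF \<open>simple_borel g\<close>]] by simp
qed

text \<open>\<open>borel_extension\<close> speaks about star sets only; realising a simple function
  as a radial function is what makes its extension values available.\<close>

lemma bounded_borel_star_of:
  assumes "simple_borel f"
  shows "bounded_borel_star_set (star_of f)"
proof -
  note nn = simple_borel_nonneg[OF assms]
  have "radial (star_of f) \<in> borel_measurable sphere_borel"
    using simple_borel_measurable[OF assms] nn
    by (subst measurable_cong[of _ _ f]) (auto simp: space_restrict_space radial_star_of)
  moreover have "radial (star_of f) ` unit_sphere = f ` unit_sphere"
    by (intro image_cong) (auto simp: radial_star_of nn)
  then have "bounded (radial (star_of f) ` unit_sphere)"
    using finite_imp_bounded[OF simple_borel_finite[OF assms]] by metis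
  moreover have "star_set (star_of f)" by (rule star_set_star_of) (rule nn)
  ultimately show ?thesis unfolding bounded_borel_star_set_def by (intro conjI)
qed

lemma extension_value_cong:
  assumes "\<And>t. t \<in> unit_sphere \<Longrightarrow> f t = g t"
  shows "extension_value U f v \<longleftrightarrow> extension_value U g v"
proof -
  have "uniform_limit unit_sphere F f sequentially \<longleftrightarrow> uniform_limit unit_sphere F g sequentially" for F
    using assms by (intro uniform_limit_cong') auto
  then show ?thesis by (simp add: extension_value_def)
qed

section \<open>The set functions \<open>nu\<close> of one nonnegative component\<close>

text \<open>Collects what the measures are built from; it is instantiated for both components of a
  decomposition of the valuation.\<close>

locale extendable =
  fixes U :: "(real ^ 'n) set \<Rightarrow> real"
  assumes nonneg: "star_body L \<Longrightarrow> 0 \<le> U L"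
    and zero: "U {0} = 0"
    and extends: "simple_borel f \<Longrightarrow> \<exists>v. extension_value U f v"
begin

text \<open>The constant sequence \<open>f\<close> is one of the approximating sequences, and limits
  are unique.\<close>

lemma extension_value_simple:
  assumes "simple_borel f" "extension_value U f v"
  shows "v = simple_extension U f"
proof -
  have "(\<lambda>k :: nat. simple_extension U f) \<longlonglongrightarrow> v"
    using assms(2)[unfolded extension_value_def, rule_format, of "\<lambda>_. f"] assms(1)
    by (simp add: uniform_limit_const)
  then show ?thesis by (simp add: LIMSEQ_const_iff)
qed

text \<open>This is the continuity from which both the continuity of \<open>nu\<close> in the level
  and its additivity in the set are drawn. It holds because an extension value is the limit along
  every approximating sequence.\<close>

lemma simple_extension_tendsto:
  assumes "simple_borel f" "\<And>k. simple_borel (F k)" "uniform_limit unit_sphere F f sequentially"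
  shows "(\<lambda>k. simple_extension U (F k)) \<longlonglongrightarrow> simple_extension U f"
proof -
  obtain v where v: "extension_value U f v" using extends assms(1) by blast
  then have "(\<lambda>k. simple_extension U (F k)) \<longlonglongrightarrow> v"
    using assms unfolding extension_value_def by blast
  then show ?thesis using extension_value_simple[OF assms(1) v] by simp
qed

lemma zeta_le:
  assumes "continuous_on unit_sphere f" "\<And>t. t \<in> unit_sphere \<Longrightarrow> 0 \<le> f t"
    "\<And>t. t \<in> C \<Longrightarrow> a \<le> f t" "sup_norm f \<le> a"
  shows "zeta U a C \<le> U (star_of f)"
  unfolding zeta_def
proof (rule cInf_lower)
  show "U (star_of f) \<in> {U (star_of f) |f. continuous_on unit_sphere f \<and>
      (\<forall>t\<in>unit_sphere. 0 \<le> f t) \<and> (\<forall>t\<in>C. a \<le> f t) \<and> sup_norm f \<le> a}"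
    using assms by (intro CollectI exI[of _ f] conjI refl ballI)
  show "bdd_below {U (star_of f) |f. continuous_on unit_sphere f \<and> (\<forall>t\<in>unit_sphere. 0 \<le> f t) \<and>
      (\<forall>t\<in>C. a \<le> f t) \<and> sup_norm f \<le> a}"
    by (rule bdd_belowI[of _ 0], elim CollectE exE conjE, hypsubst, rule nonneg,
        rule star_body_star_of, assumption, erule bspec)
qed

lemma zeta_nonneg:
  assumes "0 \<le> a"
  shows "0 \<le> zeta U a C"
  unfolding zeta_def
proof (rule cInf_greatest)
  \<comment> \<open>The constant function \<open>a\<close> is a competitor for every
    \<open>C\<close>, so the infimum is not taken over the empty set.\<close>
  have "U (star_of (\<lambda>_. a)) \<in> {U (star_of f) |f. continuous_on unit_sphere f \<and>
      (\<forall>t\<in>unit_sphere. 0 \<le> f t) \<and> (\<forall>t\<in>C. a \<le> f t) \<and> sup_norm f \<le> a}"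
    using assms by (intro CollectI exI[of _ "\<lambda>_. a"] conjI refl ballI) (simp_all add: sup_norm_const)
  then show "{U (star_of f) |f. continuous_on unit_sphere f \<and> (\<forall>t\<in>unit_sphere. 0 \<le> f t) \<and>
      (\<forall>t\<in>C. a \<le> f t) \<and> sup_norm f \<le> a} \<noteq> {}"
    by (rule ex_in_conv[THEN iffD1, OF exI])
qed (elim CollectE exE conjE, hypsubst, rule nonneg, rule star_body_star_of, assumption, erule bspec)

lemma zeta_le_const: "0 \<le> a \<Longrightarrow> zeta U a C \<le> U (star_of (\<lambda>_. a))"
  by (intro zeta_le) (auto simp: sup_norm_const)

lemma const_zero: "U (star_of (\<lambda>_. 0)) = 0"
  by (simp add: star_of_zero zero)

lemma zeta_empty: "0 \<le> a \<Longrightarrow> zeta U a {} = 0"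
  using zeta_le[of "\<lambda>_. 0" "{}" a] zeta_nonneg[of a "{}"] by (simp add: sup_norm_const const_zero)

definition open_content :: "real \<Rightarrow> (real ^ 'n) set \<Rightarrow> real" where
  "open_content a G = Sup {zeta U a C | C. closed C \<and> C \<subseteq> G}"

text \<open>The empty closed set contributes the value 0, and the constant function \<open>a\<close>
  bounds all \<open>zeta U a C\<close> at once, so the supremum is a genuine one.\<close>

lemma
  assumes "0 \<le> a"
  shows open_content_nonneg: "0 \<le> open_content a G"
    and open_content_le: "open_content a G \<le> U (star_of (\<lambda>_. a))"
proof -
  define X where "X = {zeta U a C | C. closed C \<and> C \<subseteq> G}"
  have "0 \<in> X"
    unfolding X_def using zeta_empty[OF assms] by (intro CollectI exI[of _ "{}"]) auto
  moreover have le: "x \<le> U (star_of (\<lambda>_. a))" if "x \<in> X" for x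
    using that zeta_le_const[OF assms] unfolding X_def by (elim CollectE exE conjE) simp
  moreover have "bdd_above X" using le by (rule bdd_aboveI)
  ultimately have "0 \<le> Sup X" "Sup X \<le> U (star_of (\<lambda>_. a))"
    by (auto intro: cSup_upper cSup_least)
  then show "0 \<le> open_content a G" and "open_content a G \<le> U (star_of (\<lambda>_. a))"
    unfolding open_content_def X_def .
qed

lemma open_content_empty: "0 \<le> a \<Longrightarrow> open_content a {} = 0"
proof -
  assume "0 \<le> a"
  have "{zeta U a C | C. closed C \<and> C \<subseteq> {}} = {zeta U a {}}"
    by (simp add: subset_empty)
  then show ?thesis using zeta_empty[OF \<open>0 \<le> a\<close>] by (simp only: open_content_def cSup_singleton)
qed

lemma nu_eq_INF: "nu U a A = (INF G\<in>{G. openin (top_of_set unit_sphere) G \<and> A \<subseteq> G}. open_content a G)"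
  unfolding nu_def open_content_def image_Collect ..

lemma nu_le:
  assumes "0 \<le> a" "openin (top_of_set unit_sphere) G" "A \<subseteq> G"
  shows "nu U a A \<le> open_content a G"
  unfolding nu_eq_INF
  using assms open_content_nonneg[OF assms(1)] by (intro cINF_lower bdd_belowI2[of _ 0]) auto

text \<open>The outer approximation is stated with \<open>nu\<close> of the open set itself, as
  Alexandroff's theorem requires: an open set covers itself, so its \<open>nu\<close> is at most its
  \<open>open_content\<close>.\<close>

lemma
  assumes "0 \<le> a" "A \<subseteq> unit_sphere"
  shows nu_nonneg: "0 \<le> nu U a A"
    and nu_outer: "0 < e \<Longrightarrow>
      \<exists>G. openin (top_of_set unit_sphere) G \<and> A \<subseteq> G \<and> nu U a G < nu U a A + e"
proof -
  have ne: "{G. openin (top_of_set unit_sphere) G \<and> A \<subseteq> G} \<noteq> {}"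
    using assms(2) openin_subtopology_self by blast
  then show "0 \<le> nu U a A"
    unfolding nu_eq_INF using open_content_nonneg[OF assms(1)] by (rule cINF_greatest)
  assume "0 < e"
  have "\<exists>G. openin (top_of_set unit_sphere) G \<and> A \<subseteq> G \<and> open_content a G < nu U a A + e"
  proof (rule ccontr)
    assume "\<not> ?thesis"
    then have "nu U a A + e \<le> nu U a A"
      using ne by (subst (2) nu_eq_INF, intro cINF_greatest) (auto simp: not_less)
    then show False using \<open>0 < e\<close> by simp
  qed
  then show "\<exists>G. openin (top_of_set unit_sphere) G \<and> A \<subseteq> G \<and> nu U a G < nu U a A + e"
    using nu_le[OF assms(1) _ order_refl] by (meson le_less_trans)
qed

lemma nu_level_zero: "A \<subseteq> unit_sphere \<Longrightarrow> nu U 0 A = 0"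
  using nu_le[of 0 unit_sphere A] open_content_le[of 0 unit_sphere] nu_nonneg[of 0 A]
  by (simp add: const_zero)

lemma nu_empty: "0 \<le> a \<Longrightarrow> nu U a {} = 0"
  using nu_le[of a "{}" "{}"] nu_nonneg[of a "{}"] by (simp add: open_content_empty)

text \<open>Values in \<open>T\<close> that are not attained have empty level sets and add 0.
  Summing over a superset of the range avoids distinguishing which of the sets involved are
  empty.\<close>

lemma simple_extension_eq_sum:
  assumes "finite T" "g ` unit_sphere \<subseteq> T" "T \<subseteq> {0..}"
  shows "simple_extension U g = (\<Sum>a\<in>T. nu U a {t \<in> unit_sphere. g t = a})"
  unfolding simple_extension_def
proof (rule sum.mono_neutral_left[OF assms(1,2)], rule ballI)
  fix a assume a: "a \<in> T - g ` unit_sphere"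
  then have "{t \<in> unit_sphere. g t = a} = {}" by auto
  moreover have "0 \<le> a" using a assms(3) by auto
  ultimately show "nu U a {t \<in> unit_sphere. g t = a} = 0" by (simp only: nu_empty)
qed

text \<open>The value 0 can be left out because \<open>nu\<close> vanishes at level 0.\<close>

lemma simple_extension_eq_sum_pos:
  assumes "finite T" "g ` unit_sphere \<subseteq> insert 0 T" "T \<subseteq> {0<..}"
  shows "simple_extension U g = (\<Sum>a\<in>T. nu U a {t \<in> unit_sphere. g t = a})"
proof -
  have "simple_extension U g = (\<Sum>a\<in>insert 0 T. nu U a {t \<in> unit_sphere. g t = a})"
    using assms by (intro simple_extension_eq_sum) auto
  also have "\<dots> = nu U 0 {t \<in> unit_sphere. g t = 0} + (\<Sum>a\<in>T. nu U a {t \<in> unit_sphere. g t = a})"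
    using assms by (intro sum.insert) auto
  also have "nu U 0 {t \<in> unit_sphere. g t = 0} = 0"
    by (rule nu_level_zero) blast
  finally show ?thesis by simp
qed

text \<open>The extended value of \<open>c\<close> times the indicator of \<open>A\<close> is
  \<open>nu U c A\<close>, and these functions converge uniformly when the levels do.\<close>

lemma nu_tendsto:
  assumes A: "A \<in> sets sphere_borel" and "0 \<le> a" "\<And>k. 0 \<le> b k" "b \<longlonglongrightarrow> a"
  shows "(\<lambda>k. nu U (b k) A) \<longlonglongrightarrow> nu U a A"
proof -
  have AS: "A \<subseteq> unit_sphere" using sets.sets_into_space[OF A] by (simp add: space_restrict_space)
  have simple: "simple_borel (\<lambda>t. c * indicator A t)" if "0 \<le> c" for c
  proof (rule simple_borelI)
    show "(\<lambda>t. c * indicator A t) \<in> borel_measurable sphere_borel"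
      using A by (intro borel_measurable_times borel_measurable_indicator) auto
    have "(\<lambda>t. c * indicator A t) ` unit_sphere \<subseteq> {0, c}" by (auto simp: indicator_def)
    then show "finite ((\<lambda>t. c * indicator A t) ` unit_sphere)" by (rule finite_subset) simp
  qed (use that in auto)
  have ext: "simple_extension U (\<lambda>t. c * indicator A t) = nu U c A" if "0 \<le> c" for c
  proof -
    have range: "(\<lambda>t. c * indicator A t) ` unit_sphere \<subseteq> {0, c}" by (auto simp: indicator_def)
    show ?thesis
    \<comment> \<open>For \<open>c = 0\<close> the level set at \<open>c\<close> is the whole sphere
      instead of \<open>A\<close>; both sides are then 0.\<close>
    proof (cases "c = 0")
      case True
      then show ?thesis
        using simple_extension_eq_sum_pos[of "{}" "\<lambda>t. c * indicator A t"] range nu_level_zero[OF AS]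
        by simp
    next
      case False
      then have "{t \<in> unit_sphere. c * indicator A t = c} = A"
        using AS by (auto simp: indicator_def)
      moreover have "simple_extension U (\<lambda>t. c * indicator A t)
          = (\<Sum>a\<in>{c}. nu U a {t \<in> unit_sphere. c * indicator A t = a})"
        using False that range by (intro simple_extension_eq_sum_pos) auto
      ultimately show ?thesis by simp
    qed
  qed
  have "uniform_limit unit_sphere (\<lambda>k t. b k * indicator A t) (\<lambda>t. a * indicator A t) sequentially"
  proof (rule uniform_limitI)
    fix e :: real assume "0 < e"
    with assms(4) have "\<forall>\<^sub>F k in sequentially. dist (b k) a < e" by (rule tendstoD)
    then show "\<forall>\<^sub>F k in sequentially. \<forall>t\<in>unit_sphere. dist (b k * indicator A t) (a * indicator A t) < e"
      by eventually_elim (use \<open>0 < e\<close> in \<open>auto simp: indicator_def\<close>)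
  qed
  from simple_extension_tendsto[OF simple simple this] show ?thesis using assms ext by simp
qed

text \<open>The function with value \<open>a\<close> on \<open>A \<union> B\<close> is a uniform limit of functions with value \<open>a\<close> on \<open>A\<close>
  and \<open>b \<noteq> a\<close> on \<open>B\<close>,
  whose extended values are sums of two terms; so additivity of \<open>nu\<close> is inherited from the
  continuity of the extension.\<close>

lemma nu_add:
  assumes A: "A \<in> sets sphere_borel" and B: "B \<in> sets sphere_borel" and disj: "A \<inter> B = {}"
    and "0 \<le> a"
  shows "nu U a (A \<union> B) = nu U a A + nu U a B"
\<comment> \<open>At level 0 the level set used below would also contain the complement of
  \<open>A \<union> B\<close>.\<close>
proof (cases "a = 0")
  case True
  then show ?thesis using sets.sets_into_space[OF A] sets.sets_into_space[OF B]
    by (simp add: space_restrict_space nu_level_zero)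
next
  case False
  then have "0 < a" using \<open>0 \<le> a\<close> by simp
  have S: "A \<subseteq> unit_sphere" "B \<subseteq> unit_sphere"
    using sets.sets_into_space[OF A] sets.sets_into_space[OF B] by (simp_all add: space_restrict_space)
  define F where "F c t = a * indicator A t + c * indicator B t" for c and t :: "real ^ 'n"
  define b where "b k = a + inverse (real (Suc k))" for k
  have b: "a < b k" for k by (simp add: b_def)
  have "(\<lambda>k. a + inverse (real (Suc k))) \<longlonglongrightarrow> a + 0"
    by (intro tendsto_add tendsto_const LIMSEQ_inverse_real_of_nat)
  then have b_lim: "b \<longlonglongrightarrow> a" unfolding b_def by simp
  have range: "F c ` unit_sphere \<subseteq> {0, a, c}" for c
    using disj by (auto simp: F_def indicator_def)
  have simple: "simple_borel (F c)" if "a \<le> c" for c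
  proof (rule simple_borelI)
    show "F c \<in> borel_measurable sphere_borel"
      unfolding F_def using A B
      by (intro borel_measurable_add borel_measurable_times borel_measurable_indicator) auto
    show "finite (F c ` unit_sphere)" using range by (rule finite_subset) simp
  qed (use that \<open>0 < a\<close> in \<open>auto simp: F_def indicator_def\<close>)
  have "simple_extension U (F (b k)) = nu U a A + nu U (b k) B" for k
  proof -
    have "{t \<in> unit_sphere. F (b k) t = a} = A" "{t \<in> unit_sphere. F (b k) t = b k} = B"
      using S disj \<open>0 < a\<close> b[of k] by (auto simp: F_def indicator_def split: if_splits)
    moreover have "simple_extension U (F (b k))
        = (\<Sum>c\<in>{a, b k}. nu U c {t \<in> unit_sphere. F (b k) t = c})"
      using \<open>0 < a\<close> b[of k] range by (intro simple_extension_eq_sum_pos) auto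
    moreover have "\<dots> = nu U a {t \<in> unit_sphere. F (b k) t = a}
        + nu U (b k) {t \<in> unit_sphere. F (b k) t = b k}"
      using b[of k] by (subst sum.insert) auto
    ultimately show ?thesis by (simp only:)
  qed
  moreover have "simple_extension U (F a) = nu U a (A \<union> B)"
  proof -
    have "{t \<in> unit_sphere. F a t = a} = A \<union> B"
      using S disj \<open>0 < a\<close> by (auto simp: F_def indicator_def split: if_splits)
    moreover have "simple_extension U (F a) = (\<Sum>c\<in>{a}. nu U c {t \<in> unit_sphere. F a t = c})"
      using \<open>0 < a\<close> range[of a] by (intro simple_extension_eq_sum_pos) auto
    moreover have "\<dots> = nu U a {t \<in> unit_sphere. F a t = a}" by simp
    ultimately show ?thesis by (simp only:)
  qed
  moreover have "uniform_limit unit_sphere (\<lambda>k. F (b k)) (F a) sequentially"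
  proof (rule uniform_limitI)
    fix e :: real assume "0 < e"
    with b_lim have "\<forall>\<^sub>F k in sequentially. dist (b k) a < e" by (rule tendstoD)
    then show "\<forall>\<^sub>F k in sequentially. \<forall>t\<in>unit_sphere. dist (F (b k) t) (F a t) < e"
      by eventually_elim (use \<open>0 < e\<close> in \<open>auto simp: F_def indicator_def\<close>)
  qed
  ultimately have "(\<lambda>k. nu U a A + nu U (b k) B) \<longlonglongrightarrow> nu U a (A \<union> B)"
    using simple_extension_tendsto[of "F a" "\<lambda>k. F (b k)"] simple b by (simp add: less_imp_le)
  moreover have "(\<lambda>k. nu U a A + nu U (b k) B) \<longlonglongrightarrow> nu U a A + nu U a B"
    using \<open>0 < a\<close> b by (intro tendsto_add tendsto_const nu_tendsto[OF B] b_lim) (auto intro: less_imp_le less_trans)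
  ultimately show ?thesis by (rule LIMSEQ_unique)
qed

section \<open>The level measures and their null sets\<close>

definition nu_measure :: "real \<Rightarrow> (real ^ 'n) measure" where
  "nu_measure a = measure_of unit_sphere (sets sphere_borel) (\<lambda>A. ennreal (nu U a A))"

lemma space_nu_measure: "space (nu_measure a) = unit_sphere"
  and sets_nu_measure: "sets (nu_measure a) = sets sphere_borel"
  using sets.space_closed[of "sphere_borel :: (real ^ 'n) measure"]
    sets.sigma_sets_eq[of "sphere_borel :: (real ^ 'n) measure"]
  by (simp_all add: nu_measure_def space_restrict_space)

lemma emeasure_nu_measure:
  assumes "0 \<le> a" "A \<in> sets sphere_borel"
  shows "emeasure (nu_measure a) A = ennreal (nu U a A)"
proof (rule emeasure_measure_of[OF nu_measure_def])
  have sub: "A \<subseteq> unit_sphere" if "A \<in> sets sphere_borel" for A :: "(real ^ 'n) set"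
    using sets.sets_into_space[OF that] by (simp add: space_restrict_space)
  show "sets sphere_borel \<subseteq> Pow (unit_sphere :: (real ^ 'n) set)" using sub by blast
  show "positive (sets (nu_measure a)) (\<lambda>A. ennreal (nu U a A))"
    using nu_empty[OF assms(1)] by (simp add: positive_def)
  show "countably_additive (sets (nu_measure a)) (\<lambda>A. ennreal (nu U a A))"
    unfolding sets_nu_measure
    by (rule finitely_additive_regular_countably_additive)
      (auto intro!: nu_nonneg nu_add nu_outer assms sub)
qed (use assms in \<open>simp add: sets_nu_measure\<close>)

lemma measure_nu_measure:
  "0 \<le> a \<Longrightarrow> A \<in> sets sphere_borel \<Longrightarrow> measure (nu_measure a) A = nu U a A"
  using emeasure_nu_measure nu_nonneg sets.sets_into_space[of A sphere_borel]
  by (simp add: measure_def space_restrict_space)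

lemma finite_measure_nu_measure: "0 \<le> a \<Longrightarrow> finite_measure (nu_measure a)"
  using emeasure_nu_measure[of a unit_sphere] sets.top[of "sphere_borel :: (real ^ 'n) measure"]
  by (intro finite_measureI) (simp add: space_nu_measure space_restrict_space)

text \<open>Continuity of \<open>nu\<close> in the level carries null sets over from rational levels
  to all levels, so dominating countably many measures is enough.\<close>

lemma absolutely_continuous_nu_measure:
  assumes M: "sets M = sets sphere_borel"
    and rat: "\<And>q. q \<in> \<rat> \<Longrightarrow> 0 \<le> q \<Longrightarrow> absolutely_continuous M (nu_measure q)"
    and "0 \<le> a"
  shows "absolutely_continuous M (nu_measure a)"
  unfolding absolutely_continuous_def
proof
  fix A assume A: "A \<in> null_sets M"
  then have AM: "A \<in> sets sphere_borel" using M by auto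
  \<comment> \<open>Approximation from above keeps the rational levels nonnegative, even for
    \<open>a = 0\<close>.\<close>
  have "\<exists>q\<in>\<rat>. a < q \<and> q < a + inverse (real (Suc k))" for k
    by (intro Rats_dense_in_real) simp
  then obtain q where q: "\<And>k. q k \<in> \<rat>" "\<And>k. a < q k" "\<And>k. q k < a + inverse (real (Suc k))"
    by metis
  have "nu U (q k) A = 0" for k
  proof -
    have "0 \<le> q k" using q(2)[of k] \<open>0 \<le> a\<close> by simp
    then have "A \<in> null_sets (nu_measure (q k))"
      using rat[OF q(1)] A by (auto simp: absolutely_continuous_def)
    then show ?thesis
      using measure_nu_measure[OF \<open>0 \<le> q k\<close> AM] by (simp add: measure_def null_sets_def)
  qed
  moreover have "q \<longlonglongrightarrow> a"
  proof (rule tendsto_sandwich[of "\<lambda>_. a" q _ "\<lambda>k. a + inverse (real (Suc k))"])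
    have "(\<lambda>k. a + inverse (real (Suc k))) \<longlonglongrightarrow> a + 0"
      by (intro tendsto_add tendsto_const LIMSEQ_inverse_real_of_nat)
    then show "(\<lambda>k. a + inverse (real (Suc k))) \<longlonglongrightarrow> a" by simp
  qed (use q in \<open>auto intro!: always_eventually less_imp_le\<close>)
  then have "(\<lambda>k. nu U (q k) A) \<longlonglongrightarrow> nu U a A"
    using q(2) \<open>0 \<le> a\<close> by (intro nu_tendsto[OF AM]) (auto intro: less_imp_le order_trans)
  ultimately have "nu U a A = 0" by (simp add: LIMSEQ_const_iff)
  then show "A \<in> null_sets (nu_measure a)"
    using emeasure_nu_measure[OF \<open>0 \<le> a\<close> AM] AM by (simp add: null_sets_def sets_nu_measure)
qed

end

section \<open>A common dominating measure and real densities\<close>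

text \<open>The dominating measure is a series of the given measures with positive weights, chosen
  small enough for the total mass to be finite.\<close>

lemma countable_family_dominated:
  assumes "countable \<N>" "\<N> \<noteq> {}"
    and N: "\<And>N. N \<in> \<N> \<Longrightarrow> finite_measure N \<and> sets N = sets M"
  shows "\<exists>\<mu>. finite_measure \<mu> \<and> sets \<mu> = sets M \<and> (\<forall>N\<in>\<N>. absolutely_continuous \<mu> N)"
proof -
  define P where "P = from_nat_into \<N>"
  have fin: "finite_measure (P k)" and sets_P: "sets (P k) = sets M" for k
    using N[OF from_nat_into[OF assms(2), of k]] by (auto simp: P_def)
  \<comment> \<open>The \<open>k\<close>-th term gets mass at most \<open>(1/2) ^ Suc k\<close>;
    adding 1 keeps the denominator positive for a zero measure.\<close>
  define w where "w k = (1/2) ^ Suc k / (1 + measure (P k) (space M))" for k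
  have w_pos: "0 < w k" for k by (simp add: w_def add_pos_nonneg)
  define e where "e A = (\<Sum>k. ennreal (w k) * emeasure (P k) A)" for A
  define \<mu> where "\<mu> = measure_of (space M) (sets M) e"
  have sets_\<mu>: "sets \<mu> = sets M" and space_\<mu>: "space \<mu> = space M"
    using sets.space_closed[of M] sets.sigma_sets_eq[of M] by (simp_all add: \<mu>_def)
  have "countably_additive (sets M) e"
  proof (rule countably_additiveI)
    fix A :: "nat \<Rightarrow> _" assume A: "range A \<subseteq> sets M" "disjoint_family A" "(\<Union>i. A i) \<in> sets M"
    \<comment> \<open>The inner series is read as an integral over counting measure in order to
      interchange the two summations.\<close>
    have "(\<Sum>i. e (A i)) = (\<Sum>i. \<integral>\<^sup>+k. ennreal (w k) * emeasure (P k) (A i) \<partial>count_space UNIV)"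
      by (simp add: e_def nn_integral_count_space_nat)
    also have "\<dots> = (\<integral>\<^sup>+k. (\<Sum>i. ennreal (w k) * emeasure (P k) (A i)) \<partial>count_space UNIV)"
      by (rule nn_integral_suminf[symmetric]) simp
    also have "\<dots> = e (\<Union>i. A i)"
      using A by (simp add: e_def nn_integral_count_space_nat suminf_emeasure sets_P)
    finally show "(\<Sum>i. e (A i)) = e (\<Union>i. A i)" .
  qed
  then have emeasure_\<mu>: "emeasure \<mu> A = e A" if "A \<in> sets M" for A
    using that sets.space_closed[of M] sets_\<mu>
    by (intro emeasure_measure_of[OF \<mu>_def]) (auto simp: positive_def e_def)
  have "e (space M) \<le> (\<Sum>k. ennreal ((1/2) ^ Suc k))"
    unfolding e_def
  proof (intro suminf_le summableI)
    fix k
    interpret finite_measure "P k" by (rule fin)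
    have "w k * measure (P k) (space M) \<le> (1/2) ^ Suc k"
      by (simp add: w_def field_simps add_pos_nonneg)
    then show "ennreal (w k) * emeasure (P k) (space M) \<le> ennreal ((1/2) ^ Suc k)"
      using w_pos[of k] by (simp add: emeasure_eq_measure ennreal_mult[symmetric] ennreal_leI)
  qed
  also have "\<dots> = ennreal (\<Sum>k. (1/2) ^ Suc k)"
    by (intro suminf_ennreal2) (auto simp: summable_geometric)
  also have "\<dots> < top" by (rule ennreal_less_top)
  finally have "e (space M) \<noteq> \<infinity>" by simp
  then have "finite_measure \<mu>"
    by (intro finite_measureI) (simp add: emeasure_\<mu> space_\<mu>)
  moreover have "absolutely_continuous \<mu> N" if "N \<in> \<N>" for N
    unfolding absolutely_continuous_def
  proof
    fix A assume A: "A \<in> null_sets \<mu>"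
    then have AM: "A \<in> sets M" using sets_\<mu> by auto
    from from_nat_into_surj[OF assms(1) that] obtain k where k: "N = P k" by (auto simp: P_def)
    have "e A = 0" using A emeasure_\<mu>[OF AM] by auto
    then have "\<forall>k. ennreal (w k) * emeasure (P k) A = 0"
      unfolding e_def by (simp add: suminf_eq_zero_iff)
    from spec[OF this, of k] have "emeasure (P k) A = 0"
      using w_pos[of k] by (simp add: ennreal_eq_0_iff)
    then show "A \<in> null_sets N" using AM k sets_P by auto
  qed
  ultimately show ?thesis using sets_\<mu> by blast
qed

text \<open>The Radon-Nikodym derivative of a finite measure agrees almost everywhere with a
  nonnegative real function, whose integral is the total mass of \<open>N\<close>.\<close>

lemma finite_measure_real_density:
  assumes "finite_measure \<mu>" "finite_measure N" "sets N = sets \<mu>" "absolutely_continuous \<mu> N"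
  shows "\<exists>D. integrable \<mu> D \<and> (\<forall>A\<in>sets \<mu>. measure N A = (\<integral>t. indicator A t * D t \<partial>\<mu>))"
proof -
  interpret finite_measure \<mu> by fact
  interpret N: finite_measure N by fact
  obtain D where D: "D \<in> borel_measurable \<mu>" "AE x in \<mu>. RN_deriv \<mu> N x = ennreal (D x)"
    "\<And>x. 0 \<le> D x"
    using real_RN_deriv[OF assms(2,4,3)] by metis
  have "N = density \<mu> (RN_deriv \<mu> N)" using density_RN_deriv[OF assms(4,3)] by simp
  also have "\<dots> = density \<mu> (\<lambda>x. ennreal (D x))" using D by (intro density_cong) auto
  finally have dens: "N = density \<mu> (\<lambda>x. ennreal (D x))" .
  have N: "emeasure N A = (\<integral>\<^sup>+t. ennreal (indicator A t * D t) \<partial>\<mu>)" if "A \<in> sets \<mu>" for A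
    using D that unfolding dens
    by (subst emeasure_density) (auto intro!: nn_integral_cong simp: indicator_def)
  have int: "integrable \<mu> D"
  proof (rule integrableI_nonneg)
    have "(\<integral>\<^sup>+t. ennreal (D t) \<partial>\<mu>) = emeasure N (space \<mu>)"
      using N[OF sets.top] by (auto intro!: nn_integral_cong)
    then show "(\<integral>\<^sup>+t. ennreal (D t) \<partial>\<mu>) < \<infinity>" by (simp add: N.emeasure_eq_measure)
  qed (use D in auto)
  have "measure N A = (\<integral>t. indicator A t * D t \<partial>\<mu>)" if "A \<in> sets \<mu>" for A
    unfolding measure_def N[OF that] using D that
    by (intro integral_eq_nn_integral[symmetric]) auto
  with int show ?thesis by blast
qed

section \<open>The integral representation\<close>

lemma borel_extension_simple_value:
  assumes "borel_extension V Vbar"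
  obtains V1 V2 where "extendable V1" "extendable V2"
    "\<And>L. star_set L \<Longrightarrow> simple_borel (radial L) \<Longrightarrow>
      Vbar L = V {0} + simple_extension V1 (radial L) - simple_extension V2 (radial L)"
proof -
  obtain V1 V2 where dec: "valuation_decomposition V V1 V2"
    and ext: "\<And>L. bounded_borel_star_set L \<Longrightarrow> \<exists>v1 v2. extension_value V1 (radial L) v1 \<and>
      extension_value V2 (radial L) v2 \<and> Vbar L = V {0} + v1 - v2"
    using assms unfolding borel_extension_def by blast
  have ex: "(\<exists>v. extension_value V1 f v) \<and> (\<exists>v. extension_value V2 f v)" if f: "simple_borel f" for f
  proof -
    have "extension_value U (radial (star_of f)) v \<longleftrightarrow> extension_value U f v" for U v
      using simple_borel_nonneg[OF f] by (intro extension_value_cong) (auto simp: radial_star_of)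
    then show ?thesis using ext[OF bounded_borel_star_of[OF f]] by auto
  qed
  have ext1: "extendable V1" and ext2: "extendable V2"
    using dec ex by (auto simp: extendable_def valuation_decomposition_def)
  have "Vbar L = V {0} + simple_extension V1 (radial L) - simple_extension V2 (radial L)"
    if "star_set L" "simple_borel (radial L)" for L
  proof -
    have "bounded_borel_star_set L"
      using that simple_borel_measurable[OF that(2)] finite_imp_bounded[OF simple_borel_finite[OF that(2)]]
      by (simp add: bounded_borel_star_set_def)
    then show ?thesis
      using ext extendable.extension_value_simple[OF ext1 that(2)]
        extendable.extension_value_simple[OF ext2 that(2)] by blast
  qed
  then show ?thesis using that ext1 ext2 by blast
qed

text \<open>On the level set \<open>E a\<close> the integrand is the single density
  \<open>D a\<close>. Hence it is a finite sum of integrable functions, and its integral is the sum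
  of the \<open>nu\<close>-values of the level sets.\<close>

lemma (in extendable) simple_extension_integral:
  assumes M: "sets \<mu> = sets sphere_borel"
    and D: "\<And>a. 0 \<le> a \<Longrightarrow> integrable \<mu> (D a)"
      "\<And>a A. 0 \<le> a \<Longrightarrow> A \<in> sets sphere_borel \<Longrightarrow>
        measure (nu_measure a) A = (\<integral>t. indicator A t * D a t \<partial>\<mu>)"
    and g: "simple_borel g"
  shows "integrable \<mu> (\<lambda>t. D (g t) t)"
    and "simple_extension U g = (\<integral>t. D (g t) t \<partial>\<mu>)"
proof -
  define E where "E a = {t \<in> unit_sphere. g t = a}" for a
  have space: "space \<mu> = unit_sphere" using sets_eq_imp_space_eq[OF M] by (simp add: space_restrict_space)
  have E: "E a \<in> sets sphere_borel" for a
    unfolding E_def by (rule simple_borel_level_sets[OF g])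
  have fin: "finite (g ` unit_sphere)" by (rule simple_borel_finite[OF g])
  have nn: "0 \<le> a" if "a \<in> g ` unit_sphere" for a using that simple_borel_nonneg[OF g] by auto
  have eq: "D (g t) t = (\<Sum>a\<in>g ` unit_sphere. indicator (E a) t * D a t)" if "t \<in> space \<mu>" for t
  proof -
    have "(\<Sum>a\<in>g ` unit_sphere. indicator (E a) t * D a t)
        = (\<Sum>a\<in>g ` unit_sphere. if a = g t then D (g t) t else 0)"
      using that space by (intro sum.cong) (auto simp: E_def)
    also have "\<dots> = D (g t) t"
    proof -
      have "g t \<in> g ` unit_sphere" using that space by blast
      then show ?thesis using fin by simp
    qed
    finally show ?thesis by simp
  qed
  have int: "integrable \<mu> (\<lambda>t. indicator (E a) t * D a t)" if "a \<in> g ` unit_sphere" for a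
    using integrable_mult_indicator[of "E a" \<mu> "D a"] D(1)[OF nn[OF that]] E M by simp
  show "integrable \<mu> (\<lambda>t. D (g t) t)"
    by (subst Bochner_Integration.integrable_cong[OF refl eq])
      (assumption, rule Bochner_Integration.integrable_sum[OF int])
  have "simple_extension U g = (\<Sum>a\<in>g ` unit_sphere. \<integral>t. indicator (E a) t * D a t \<partial>\<mu>)"
    unfolding simple_extension_def
    by (intro sum.cong) (simp_all add: D(2)[symmetric] nn E measure_nu_measure, simp add: E_def)
  also have "\<dots> = (\<integral>t. (\<Sum>a\<in>g ` unit_sphere. indicator (E a) t * D a t) \<partial>\<mu>)"
    by (rule Bochner_Integration.integral_sum[symmetric]) (rule int)
  also have "\<dots> = (\<integral>t. D (g t) t \<partial>\<mu>)"
    by (intro Bochner_Integration.integral_cong) (simp_all add: eq)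
  finally show "simple_extension U g = (\<integral>t. D (g t) t \<partial>\<mu>)" .
qed

theorem theorem1p2:
  fixes V Vbar :: "(real ^ 'n) set \<Rightarrow> real"
  assumes "valuation V" and "radial_continuous V"
    and "borel_extension V Vbar"
  shows "\<exists>(\<mu> :: (real ^ 'n) measure) (K :: real \<Rightarrow> real ^ 'n \<Rightarrow> real).
           sets \<mu> = sets sphere_borel \<and>
           (\<forall>L. star_set L \<and> simple_borel (radial L) \<longrightarrow>
              integrable \<mu> (\<lambda>t. K (radial L t) t) \<and>
              Vbar L = (\<integral>t. K (radial L t) t \<partial>\<mu>))"
proof -
  obtain V1 V2 where "extendable V1" "extendable V2"
    and Vbar: "\<And>L. star_set L \<Longrightarrow> simple_borel (radial L) \<Longrightarrow>
      Vbar L = V {0} + simple_extension V1 (radial L) - simple_extension V2 (radial L)"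
    using borel_extension_simple_value[OF assms(3)] by metis
  interpret V1: extendable V1 by fact
  interpret V2: extendable V2 by fact
  obtain t0 :: "real ^ 'n" where t0: "t0 \<in> unit_sphere" using unit_sphere_nonempty by blast
  \<comment> \<open>The point mass makes the total mass of \<open>\<mu>\<close> positive, so that the constant \<open>V {0}\<close> can be
    represented as an integral.\<close>
  define \<delta> where "\<delta> = distr (count_space {t0}) sphere_borel (\<lambda>t. t)"
  have id: "(\<lambda>t. t) \<in> count_space {t0} \<rightarrow>\<^sub>M sphere_borel"
    using t0 by (simp add: space_restrict_space)
  have "finite_measure \<delta>"
    unfolding \<delta>_def by (intro finite_measure.finite_measure_distr finite_measure_count_space id) simp
  \<comment> \<open>Both components enter one countable family, so that their densities refer to the
    same \<open>\<mu>\<close>.\<close>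
  define \<N> where "\<N> = insert \<delta> (V1.nu_measure ` (\<rat> \<inter> {0..}) \<union> V2.nu_measure ` (\<rat> \<inter> {0..}))"
  have "countable \<N>" unfolding \<N>_def by (auto intro!: countable_Int1 countable_rat)
  moreover have "finite_measure N \<and> sets N = sets sphere_borel" if "N \<in> \<N>" for N
    using that \<open>finite_measure \<delta>\<close> V1.finite_measure_nu_measure V2.finite_measure_nu_measure
    by (auto simp: \<N>_def V1.sets_nu_measure V2.sets_nu_measure \<delta>_def)
  moreover have "\<N> \<noteq> {}" by (simp add: \<N>_def)
  ultimately obtain \<mu> where "finite_measure \<mu>" and sets_\<mu>: "sets \<mu> = sets sphere_borel"
    and dom: "\<And>N. N \<in> \<N> \<Longrightarrow> absolutely_continuous \<mu> N"
    using countable_family_dominated[of \<N> sphere_borel] by blast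
  interpret finite_measure \<mu> by fact
  have space_\<mu>: "space \<mu> = unit_sphere"
    using sets_eq_imp_space_eq[OF sets_\<mu>] by (simp add: space_restrict_space)
  \<comment> \<open>Otherwise the domination of \<open>\<delta>\<close> would make the whole sphere
    a null set of a point mass.\<close>
  have "measure \<mu> (space \<mu>) \<noteq> 0"
  proof
    assume "measure \<mu> (space \<mu>) = 0"
    then have "space \<mu> \<in> null_sets \<mu>" by (simp add: emeasure_eq_measure null_sets_def)
    then have "space \<mu> \<in> null_sets \<delta>"
      using dom[of \<delta>] by (auto simp: \<N>_def absolutely_continuous_def)
    moreover have "emeasure \<delta> (space \<mu>) = emeasure (count_space {t0}) {t0}"
      unfolding \<delta>_def using id t0 sets.top[of \<mu>]
      by (subst emeasure_distr) (auto simp: sets_\<mu> space_\<mu> intro!: arg_cong2[of _ _ _ _ emeasure])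
    ultimately show False by (auto simp: null_sets_def)
  qed
  define c where "c = V {0} / measure \<mu> (space \<mu>)"
  have "\<exists>D. integrable \<mu> D \<and> (\<forall>A\<in>sets sphere_borel.
      measure (V1.nu_measure a) A = (\<integral>t. indicator A t * D t \<partial>\<mu>))" if "0 \<le> a" for a
    using finite_measure_real_density[OF \<open>finite_measure \<mu>\<close> V1.finite_measure_nu_measure[OF that]]
      V1.absolutely_continuous_nu_measure[OF sets_\<mu> dom that]
    by (simp add: V1.sets_nu_measure sets_\<mu> \<N>_def)
  \<comment> \<open>The density is chosen separately at each level.\<close>
  then obtain D1 where D1: "\<And>a. 0 \<le> a \<Longrightarrow> integrable \<mu> (D1 a)"
    "\<And>a A. 0 \<le> a \<Longrightarrow> A \<in> sets sphere_borel \<Longrightarrow>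
      measure (V1.nu_measure a) A = (\<integral>t. indicator A t * D1 a t \<partial>\<mu>)"
    by metis
  have "\<exists>D. integrable \<mu> D \<and> (\<forall>A\<in>sets sphere_borel.
      measure (V2.nu_measure a) A = (\<integral>t. indicator A t * D t \<partial>\<mu>))" if "0 \<le> a" for a
    using finite_measure_real_density[OF \<open>finite_measure \<mu>\<close> V2.finite_measure_nu_measure[OF that]]
      V2.absolutely_continuous_nu_measure[OF sets_\<mu> dom that]
    by (simp add: V2.sets_nu_measure sets_\<mu> \<N>_def)
  then obtain D2 where D2: "\<And>a. 0 \<le> a \<Longrightarrow> integrable \<mu> (D2 a)"
    "\<And>a A. 0 \<le> a \<Longrightarrow> A \<in> sets sphere_borel \<Longrightarrow>
      measure (V2.nu_measure a) A = (\<integral>t. indicator A t * D2 a t \<partial>\<mu>)"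
    by metis
  have "integrable \<mu> (\<lambda>t. c + D1 (radial L t) t - D2 (radial L t) t) \<and>
      Vbar L = (\<integral>t. c + D1 (radial L t) t - D2 (radial L t) t \<partial>\<mu>)"
    if "star_set L" "simple_borel (radial L)" for L
  proof -
    have int1: "integrable \<mu> (\<lambda>t. D1 (radial L t) t)"
        "simple_extension V1 (radial L) = (\<integral>t. D1 (radial L t) t \<partial>\<mu>)"
      by (rule V1.simple_extension_integral[OF sets_\<mu> D1 that(2)], assumption+)+
    have int2: "integrable \<mu> (\<lambda>t. D2 (radial L t) t)"
        "simple_extension V2 (radial L) = (\<integral>t. D2 (radial L t) t \<partial>\<mu>)"
      by (rule V2.simple_extension_integral[OF sets_\<mu> D2 that(2)], assumption+)+
    have int_c: "integrable \<mu> (\<lambda>t. c + D1 (radial L t) t)"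
      by (intro Bochner_Integration.integrable_add integrable_const int1(1))
    have "(\<integral>t. c + D1 (radial L t) t - D2 (radial L t) t \<partial>\<mu>)
        = (\<integral>t. c \<partial>\<mu>) + (\<integral>t. D1 (radial L t) t \<partial>\<mu>) - (\<integral>t. D2 (radial L t) t \<partial>\<mu>)"
      by (subst Bochner_Integration.integral_diff[OF int_c int2(1)])
        (subst Bochner_Integration.integral_add[OF integrable_const int1(1)], rule refl)
    also have "(\<integral>t. c \<partial>\<mu>) = V {0}"
      using \<open>measure \<mu> (space \<mu>) \<noteq> 0\<close> by (simp add: c_def)
    finally have "(\<integral>t. c + D1 (radial L t) t - D2 (radial L t) t \<partial>\<mu>) = Vbar L"
      unfolding Vbar[OF that] int1(2) int2(2) .
    then show ?thesis
      using Bochner_Integration.integrable_diff[OF int_c int2(1)] by (simp only: simp_thms)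
  qed
  then show ?thesis
    using sets_\<mu> by (intro exI[of _ \<mu>] exI[of _ "\<lambda>a t. c + D1 a t - D2 a t"]) blast
qed

end
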